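(* Let $k\in\{3,4,6\}$ and let $p$ be the largest prime factor of $k$ (so $p=3$ for $k=3,6$ and $p=2$ for $k=4$). Let $d$ be a positive integer and write $d=p^{u_0}q_1^{u_1}\cdots q_s^{u_s}$, where $s\ge 0$, $q_1,\dots,q_s$ are distinct primes different from $p$, $u_0\ge 0$ and $u_1,\dots,u_s\ge 1$. Let $N_d$ be the number of equivalence classes of primitive pairs $(t(x),r(x))$ such that $t(x)=ax+b$ with $a,b\in\mathbb{Z}$, $a\ne 0$, and $\Phi_k(t(x)-1)=d\cdot r(x)$ with $r(x)\in\mathbb{Z}[x]$ irreducible over $\mathbb{Z}$. Then $$N_d=\begin{cases}1 & \text{if } d=1 \text{ or } d=p,\\ 2^s & \text{if } q_i\equiv 1 \pmod k \text{ for all } i=1,\dots,s, \text{ and } u_0\le 1,\\ 0 & \text{otherwise.}\end{cases}$$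
   Context: $\Phi_k$ denotes the $k$-th cyclotomic polynomial. Irreducible over $\mathbb{Z}$ means irreducible as an element of $\mathbb{Z}[x]$; in particular the coefficients of $r(x)$ have gcd $1$, so $d$ is the gcd of the coefficients of $\Phi_k(t(x)-1)$. For polynomials $t,t',r,r'$ with integer coefficients: the pair $(t(x),r(x))$ is deduced from $(t'(x),r'(x))$ if $(t(x),r(x))=(t'(ux+v),r'(ux+v))$ for some $u,v\in\mathbb{Z}$, $u\ne0$; two pairs are equivalent if each can be deduced from the other, i.e. if $(t(x),r(x))=(t'(\pm x+v),r'(\pm x+v))$ for some $v\in\mathbb{Z}$ and some choice of sign; a pair is primitive if it cannot be deduced from a non-equivalent pair. *)

theory Defs
  imports
    Complex_Main
    "HOL-Computational_Algebra.Computational_Algebra"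
    "HOL-Number_Theory.Cong"
begin

definition primitive_roots_of_unity :: "nat \<Rightarrow> complex set" where
  "primitive_roots_of_unity n = {z. z ^ n = 1 \<and> (\<forall>m. 0 < m \<and> m < n \<longrightarrow> z ^ m \<noteq> 1)}"

(* The product over the primitive n-th roots of unity has integer coefficients for every n > 0,
   and the embedding of int poly into complex poly is injective, so THE picks out that
   polynomial; the lemmas below confirm this for n = 3, 4, 6. *)
definition cyclotomic :: "nat \<Rightarrow> int poly" where
  "cyclotomic n =
     (THE f. map_poly of_int f = (\<Prod>z\<in>primitive_roots_of_unity n. [:- z, 1:]))"

lemma cyclotomic_eqI:
  assumes "map_poly of_int f = (\<Prod>z\<in>primitive_roots_of_unity n. [:- z, 1:])"
  shows "cyclotomic n = f"
  unfolding cyclotomic_def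
proof (rule the_equality[where P = "\<lambda>f. map_poly of_int f = _", OF assms])
  fix g :: "int poly"
  assume "map_poly of_int g = (\<Prod>z\<in>primitive_roots_of_unity n. [:- z, 1:])"
  hence "map_poly (of_int :: int \<Rightarrow> complex) g = map_poly of_int f"
    using assms by simp
  hence "\<And>i. (of_int (coeff g i) :: complex) = of_int (coeff f i)"
    by (metis coeff_map_poly of_int_0)
  thus "g = f" by (simp add: poly_eq_iff)
qed

lemma cyclotomic_4: "cyclotomic 4 = [:1, 0, 1:]"
proof (rule cyclotomic_eqI)
  have iff: "(\<forall>m::nat. 0 < m \<and> m < 4 \<longrightarrow> P m) \<longleftrightarrow> P 1 \<and> P 2 \<and> P 3" for P
    by (auto simp: numeral_eq_Suc less_Suc_eq)
  have "z ^ 4 = 1 \<and> z ^ 2 \<noteq> 1 \<longleftrightarrow> z = \<i> \<or> z = - \<i>" for z :: complex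
  proof -
    have "z ^ 4 - 1 = 0 \<longleftrightarrow> z ^ 2 - 1 = 0 \<or> z - \<i> = 0 \<or> z + \<i> = 0"
    proof -
      have "z ^ 4 - 1 = (z ^ 2 - 1) * ((z - \<i>) * (z + \<i>))"
        by (simp add: algebra_simps power2_eq_square power4_eq_xxxx)
      thus ?thesis by (simp only: mult_eq_0_iff)
    qed
    moreover have "z = \<i> \<or> z = - \<i> \<Longrightarrow> z ^ 2 \<noteq> 1" by auto
    moreover have "z = - \<i> \<longleftrightarrow> z + \<i> = 0" by (rule eq_neg_iff_add_eq_0)
    moreover have "z ^ 4 = 1 \<longleftrightarrow> z ^ 4 - 1 = 0" "z ^ 2 = 1 \<longleftrightarrow> z ^ 2 - 1 = 0"
        "z = \<i> \<longleftrightarrow> z - \<i> = 0"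
      by simp_all
    ultimately show ?thesis
      by argo
  qed
  moreover have "z ^ 1 \<noteq> 1 \<and> z ^ 3 \<noteq> 1" if "z = \<i> \<or> z = - \<i>" for z
    using that by (auto simp: power3_eq_cube complex_eq_iff)
  ultimately have "primitive_roots_of_unity 4 = {\<i>, - \<i>}"
    unfolding primitive_roots_of_unity_def iff by blast
  thus "map_poly of_int [:1, 0, 1:] = (\<Prod>z\<in>primitive_roots_of_unity 4. [:- z, 1:])"
    by (simp add: map_poly_pCons complex_eq_iff)
qed

lemma cyclotomic_3: "cyclotomic 3 = [:1, 1, 1:]"
proof (rule cyclotomic_eqI)
  have iff: "(\<forall>m::nat. 0 < m \<and> m < 3 \<longrightarrow> P m) \<longleftrightarrow> P 1 \<and> P 2" for P
    by (auto simp: numeral_eq_Suc less_Suc_eq)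
  define w where "w = Complex (- 1 / 2) (sqrt 3 / 2)"
  define w' where "w' = Complex (- 1 / 2) (- sqrt 3 / 2)"
  have sum: "w + w' = - 1" and prod: "w * w' = 1" and ne: "w \<noteq> w'"
    by (simp_all add: w_def w'_def complex_eq_iff)
  have quad: "z ^ 2 + z + 1 = (z - w) * (z - w')" for z
  proof -
    have "(z - w) * (z - w') = z ^ 2 - (w + w') * z + w * w'"
      by (simp add: algebra_simps power2_eq_square)
    thus ?thesis by (simp add: sum prod)
  qed
  have "(z ^ 3 = 1 \<and> z \<noteq> 1 \<and> z ^ 2 \<noteq> 1) \<longleftrightarrow> z ^ 2 + z + 1 = 0" for z :: complex
  proof -
    have *: "z ^ 3 - 1 = (z - 1) * (z ^ 2 + z + 1)"
      by (simp add: algebra_simps power2_eq_square power3_eq_cube)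
    have "z ^ 2 = 1 \<Longrightarrow> z ^ 2 + z + 1 = 0 \<Longrightarrow> False"
    proof -
      assume a: "z ^ 2 = 1" "z ^ 2 + z + 1 = 0"
      hence "z = -2" by algebra
      thus False using a by simp
    qed
    moreover have "z = 1 \<Longrightarrow> z ^ 2 = 1" by simp
    moreover have "z ^ 3 - 1 = 0 \<longleftrightarrow> z - 1 = 0 \<or> z ^ 2 + z + 1 = 0"
      unfolding * by (rule mult_eq_0_iff)
    moreover have "z ^ 3 = 1 \<and> z ^ 2 = 1 \<Longrightarrow> z = 1" by algebra
    ultimately show ?thesis by auto
  qed
  hence "primitive_roots_of_unity 3 = {w, w'}"
    unfolding primitive_roots_of_unity_def iff by (auto simp: quad)
  hence "(\<Prod>z\<in>primitive_roots_of_unity 3. [:- z, 1:]) = [:w * w', - (w + w'), 1:]"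
    using ne by simp
  also have "\<dots> = map_poly of_int [:1, 1, 1:]"
    unfolding sum prod by (simp add: map_poly_pCons)
  finally show "map_poly of_int [:1, 1, 1:] =
      (\<Prod>z\<in>primitive_roots_of_unity 3. [:- z, 1:])" by (rule sym)
qed

lemma cyclotomic_6: "cyclotomic 6 = [:1, - 1, 1:]"
proof (rule cyclotomic_eqI)
  have iff: "(\<forall>m::nat. 0 < m \<and> m < 6 \<longrightarrow> P m) \<longleftrightarrow> P 1 \<and> P 2 \<and> P 3 \<and> P 4 \<and> P 5" for P
    by (auto simp: numeral_eq_Suc less_Suc_eq)
  define w where "w = Complex (1 / 2) (sqrt 3 / 2)"
  define w' where "w' = Complex (1 / 2) (- sqrt 3 / 2)"
  have sum: "w + w' = 1" and prod: "w * w' = 1" and ne: "w \<noteq> w'"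
    by (simp_all add: w_def w'_def complex_eq_iff)
  have quad: "z ^ 2 - z + 1 = (z - w) * (z - w')" for z
  proof -
    have "(z - w) * (z - w') = z ^ 2 - (w + w') * z + w * w'"
      by (simp add: algebra_simps power2_eq_square)
    thus ?thesis by (simp add: sum prod)
  qed
  have "(z ^ 6 = 1 \<and> z ^ 1 \<noteq> 1 \<and> z ^ 2 \<noteq> 1 \<and> z ^ 3 \<noteq> 1 \<and> z ^ 4 \<noteq> 1 \<and> z ^ 5 \<noteq> 1)
          \<longleftrightarrow> z ^ 2 - z + 1 = 0" for z :: complex
  proof
    assume a: "z ^ 6 = 1 \<and> z ^ 1 \<noteq> 1 \<and> z ^ 2 \<noteq> 1 \<and> z ^ 3 \<noteq> 1 \<and> z ^ 4 \<noteq> 1 \<and> z ^ 5 \<noteq> 1"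
    have "z ^ 6 - 1 = (z ^ 3 - 1) * ((z + 1) * (z ^ 2 - z + 1))"
      by (simp add: algebra_simps eval_nat_numeral)
    moreover have "z + 1 \<noteq> 0"
      using a by (auto simp: eq_neg_iff_add_eq_0[symmetric])
    ultimately show "z ^ 2 - z + 1 = 0" using a by simp
  next
    assume "z ^ 2 - z + 1 = 0"
    hence 2: "z ^ 2 = z - 1" by (simp add: algebra_simps add_eq_0_iff2)
    have 3: "z ^ 3 = - 1" using 2 by algebra
    have 4: "z ^ 4 = - z" and 5: "z ^ 5 = 1 - z" and 6: "z ^ 6 = 1"
      using 2 by algebra+
    have "z \<noteq> 1" "z \<noteq> 2" "z \<noteq> - 1" "z \<noteq> 0" using 2 by auto
    thus "z ^ 6 = 1 \<and> z ^ 1 \<noteq> 1 \<and> z ^ 2 \<noteq> 1 \<and> z ^ 3 \<noteq> 1 \<and> z ^ 4 \<noteq> 1 \<and> z ^ 5 \<noteq> 1"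
      unfolding 2 3 4 5 6 by (auto simp: minus_equation_iff algebra_simps)
  qed
  hence "primitive_roots_of_unity 6 = {w, w'}"
    unfolding primitive_roots_of_unity_def iff by (auto simp: quad)
  hence "(\<Prod>z\<in>primitive_roots_of_unity 6. [:- z, 1:]) = [:w * w', - (w + w'), 1:]"
    using ne by simp
  also have "\<dots> = map_poly of_int [:1, - 1, 1:]"
    unfolding sum prod by (simp add: map_poly_pCons)
  finally show "map_poly of_int [:1, - 1, 1:] =
      (\<Prod>z\<in>primitive_roots_of_unity 6. [:- z, 1:])" by (rule sym)
qed

type_synonym poly_pair = "int poly \<times> int poly"

definition deduced_from :: "poly_pair \<Rightarrow> poly_pair \<Rightarrow> bool" where
  "deduced_from P P' \<longleftrightarrow>
     (\<exists>u v. u \<noteq> 0 \<and> fst P = pcompose (fst P') [:v, u:] \<and> snd P = pcompose (snd P') [:v, u:])"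

definition equivalent_pairs :: "poly_pair \<Rightarrow> poly_pair \<Rightarrow> bool" where
  "equivalent_pairs P P' \<longleftrightarrow> deduced_from P P' \<and> deduced_from P' P"

definition primitive_pair :: "poly_pair \<Rightarrow> bool" where
  "primitive_pair P \<longleftrightarrow> \<not> (\<exists>P'. deduced_from P P' \<and> \<not> equivalent_pairs P P')"

definition linear_primitive_pairs :: "nat \<Rightarrow> nat \<Rightarrow> poly_pair set" where
  "linear_primitive_pairs k d =
     {(t, r). primitive_pair (t, r) \<and>
        (\<exists>a b. a \<noteq> 0 \<and> t = [:b, a:]) \<and>
        pcompose (cyclotomic k) (t - 1) = smult (int d) r \<and>
        irreducible r}"

definition linear_primitive_classes :: "nat \<Rightarrow> nat \<Rightarrow> poly_pair set set" where
  "linear_primitive_classes k d =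
     linear_primitive_pairs k d // {(P, P'). equivalent_pairs P P'}"

end

theory Submission
  imports Defs "HOL-Number_Theory.Residue_Primitive_Roots"
begin

text \<open>
  Write \<open>\<Phi>(x) = x\<^sup>2 + c x + 1\<close> for the cyclotomic polynomial, with discriminant \<open>c\<^sup>2 - 4 \<in> {- 3, - 4}\<close>,
  so that \<open>p\<close> is the only ramified prime, and \<open>p\<^sup>2\<close> divides no value of \<open>\<Phi>\<close>. With \<open>y = b - 1\<close>, the
  coefficients of \<open>\<Phi>(a x + y)\<close> are \<open>\<Phi>(y)\<close>, \<open>a (2 y + c)\<close> and \<open>a\<^sup>2\<close>. If \<open>d\<close> divides all three, then
  eliminating \<open>y\<close> gives \<open>d dvd p a\<close>, and hence \<open>d dvd a\<close>. So every pair is deduced from one with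
  leading coefficient \<open>d\<close>: the primitive pairs are those with \<open>\<bar>a\<bar> = d\<close> and \<open>d dvd \<Phi>(y)\<close>, and
  the classes correspond to the roots of \<open>\<Phi>\<close> modulo \<open>d\<close>. These are counted with the Chinese
  remainder theorem and Hensel lifting; modulo a prime \<open>q \<noteq> p\<close> the roots are the elements of
  multiplicative order \<open>k\<close>.
\<close>

hide_const (open) Module.smult up_ring.coeff

section \<open>Integer quadratics and linear substitutions\<close>

text \<open>A constant factor divides all three coefficients and is therefore a unit. Two linear
  factors would make the discriminant the square \<open>(a0 * b1 - a1 * b0)^2\<close>, which is
  never negative.\<close>

lemma quadratic_irreducible_int_poly:
  fixes r0 r1 r2 :: int
  assumes disc: "r1 * r1 - 4 * r0 * r2 < 0"
    and prim: "\<And>e. e dvd r0 \<Longrightarrow> e dvd r1 \<Longrightarrow> e dvd r2 \<Longrightarrow> e dvd 1"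
  shows "irreducible [:r0, r1, r2:]"
proof (rule irreducibleI)
  have r2: "r2 \<noteq> 0"
  proof
    assume "r2 = 0"
    with disc show False by (simp add: not_less[symmetric])
  qed
  thus "[:r0, r1, r2:] \<noteq> 0" by simp
  show "\<not> [:r0, r1, r2:] dvd 1"
    using r2 by (auto simp: is_unit_poly_iff)
  have const: "A dvd 1" if AB: "[:r0, r1, r2:] = A * B" and deg: "degree A = 0"
    for A B :: "int poly"
  proof -
    obtain e where e: "A = [:e:]" using deg by (metis degree_eq_zeroE)
    have "[:r0, r1, r2:] = smult e B" using AB e by simp
    hence "r0 = e * coeff B 0" "r1 = e * coeff B 1" "r2 = e * coeff B 2"
      by (metis coeff_smult coeff_pCons_0 coeff_pCons_Suc One_nat_def numeral_2_eq_2)+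
    hence "e dvd 1" by (intro prim) simp_all
    thus ?thesis using e by (simp add: is_unit_const_poly_iff)
  qed
  fix A B :: "int poly"
  assume AB: "[:r0, r1, r2:] = A * B"
  have nz: "A \<noteq> 0" "B \<noteq> 0" using AB r2 by auto
  have "degree A + degree B = 2"
    using degree_mult_eq[OF nz] r2 by (simp flip: AB)
  then consider "degree A = 0" | "degree B = 0" | "degree A = 1" "degree B = 1"
    by linarith
  thus "A dvd 1 \<or> B dvd 1"
  proof cases
    case 1
    thus ?thesis using const AB by blast
  next
    case 2
    thus ?thesis using const[of B A] AB by (simp add: mult.commute)
  next
    case 3
    then obtain a0 a1 b0 b1 where "A = [:a0, a1:]" "B = [:b0, b1:]"
      by (metis degree1_coeffs)
    with AB have "r0 = a0 * b0" "r1 = a0 * b1 + a1 * b0" "r2 = a1 * b1"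
      by (auto simp: algebra_simps)
    hence "r1 * r1 - 4 * r0 * r2 = (a0 * b1 - a1 * b0)\<^sup>2"
      by (simp add: power2_eq_square algebra_simps)
    with disc show ?thesis by simp
  qed
qed

text \<open>Allows an identity between polynomials to be pulled back along a substitution, from a
  pair to the pair it is deduced from.\<close>

lemma pcompose_linear_inject:
  fixes f g :: "'a::idom poly"
  assumes "u \<noteq> 0" "pcompose f [:v, u:] = pcompose g [:v, u:]"
  shows "f = g"
proof -
  have "pcompose (f - g) [:v, u:] = 0"
    using assms(2) by (simp add: pcompose_diff)
  hence "f - g = 0" using assms(1) by (subst (asm) pcompose_eq_0_iff) auto
  thus ?thesis by simp
qed

lemma deduced_from_refl: "deduced_from P P"
  unfolding deduced_from_def by (intro exI[of _ 1] exI[of _ 0]) simp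

lemma deduced_from_trans:
  assumes "deduced_from P Q" "deduced_from Q R"
  shows "deduced_from P R"
proof -
  obtain u v where 1: "u \<noteq> 0" "fst P = pcompose (fst Q) [:v, u:]" "snd P = pcompose (snd Q) [:v, u:]"
    using assms(1) unfolding deduced_from_def by blast
  obtain u' v' where 2: "u' \<noteq> 0" "fst Q = pcompose (fst R) [:v', u':]"
      "snd Q = pcompose (snd R) [:v', u':]"
    using assms(2) unfolding deduced_from_def by blast
  have "pcompose [:v', u':] [:v, u:] = [:v' + u' * v, u' * u:]"
    by (simp add: pcompose_pCons algebra_simps)
  thus ?thesis
    unfolding deduced_from_def using 1 2
    by (intro exI[of _ "u' * u"] exI[of _ "v' + u' * v"]) (simp flip: pcompose_assoc)
qed

text \<open>Since \<open>u * u = 1\<close>, the substitution \<open>x \<mapsto> u x + v\<close> has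
  the integral inverse \<open>x \<mapsto> u x - u v\<close>.\<close>

lemma deduced_from_unit_imp_equivalent:
  assumes "\<bar>u\<bar> = 1" "fst P = pcompose (fst Q) [:v, u:]" "snd P = pcompose (snd Q) [:v, u:]"
  shows "equivalent_pairs P Q"
proof -
  have "u * u = 1" using assms(1) by (auto simp: abs_if split: if_splits)
  hence id: "pcompose [:v, u:] [:- (u * v), u:] = [:0, 1:]"
    by (simp add: pcompose_pCons mult.assoc[symmetric])
  have "fst Q = pcompose (fst P) [:- (u * v), u:]" "snd Q = pcompose (snd P) [:- (u * v), u:]"
    unfolding assms(2,3) by (simp_all add: id flip: pcompose_assoc)
  moreover have "u \<noteq> 0" using assms(1) by auto
  ultimately show ?thesis
    unfolding equivalent_pairs_def deduced_from_def using assms(2,3) by blast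
qed

lemma equiv_equivalent_pairs: "equiv UNIV {(P, Q). equivalent_pairs P Q}"
  unfolding equivalent_pairs_def
  by (rule equivI)
    (auto simp: refl_on_def sym_def trans_def deduced_from_refl intro: deduced_from_trans)

text \<open>Send \<open>f x\<close> to the value of \<open>g\<close> at a chosen preimage.
  Equivalence classes and roots modulo \<open>d\<close> will both arise as images of the set of
  pairs.\<close>

lemma bij_betw_images_same_kernel:
  assumes "\<And>x y. x \<in> A \<Longrightarrow> y \<in> A \<Longrightarrow> f x = f y \<longleftrightarrow> g x = g y"
  shows "\<exists>h. bij_betw h (f ` A) (g ` A)"
proof -
  have inv: "inv_into A f (f x) \<in> A" "f (inv_into A f (f x)) = f x" if "x \<in> A" for x
    using that by (auto simp: inv_into_into f_inv_into_f)
  have "(g \<circ> inv_into A f) (f x) = g x" if "x \<in> A" for x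
    using inv[OF that] assms that by simp
  hence "bij_betw (g \<circ> inv_into A f) (f ` A) (g ` A)"
    unfolding bij_betw_def inj_on_def using assms by (auto simp: image_iff) 
  thus ?thesis by blast
qed

lemma dvd_power_diff_one_iff: "int q dvd int a ^ j - 1 \<longleftrightarrow> ord q a dvd j"
proof -
  have "int q dvd int a ^ j - 1 \<longleftrightarrow> [int (a ^ j) = int 1] (mod int q)"
    by (simp add: cong_iff_dvd_diff)
  thus ?thesis by (simp only: cong_int_iff ord_divides)
qed

section \<open>Divisibility properties of the values of the quadratic\<close>

text \<open>\<open>c\<close> is the linear coefficient of \<open>cyclotomic k\<close>, so that the
  three cases share one quadratic.\<close>

locale quadratic_cyclotomic =
  fixes k p :: nat and c :: int
  assumes params: "(k, p, c) \<in> {(3, 3, 1), (4, 2, 0), (6, 3, - 1)}"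
begin

definition phi :: "int \<Rightarrow> int" where
  "phi x = x * x + c * x + 1"

lemma prime_p: "prime p"
  using params by auto

text \<open>The discriminant identity \<open>4 phi x - (2 x + c)^2 = 4 - c^2\<close> gives 3 when
  \<open>c = 1\<close> or \<open>c = - 1\<close>. For \<open>c = 0\<close> it gives 4, and halving
  it gives 2.\<close>

lemma p_eq_combination: "\<exists>s t. int p = s * phi x + t * (2 * x + c)"
proof -
  consider "int p = 2" "c = 0" | "int p = 3" "c * c = 1"
    using params by auto
  thus ?thesis
  proof cases
    case 1
    hence "int p = 2 * phi x + (- x) * (2 * x + c)"
      unfolding phi_def by (simp add: algebra_simps)
    thus ?thesis by blast
  next
    case 2
    hence "int p = 4 * phi x + (- (2 * x + c)) * (2 * x + c)"
      unfolding phi_def by (simp add: algebra_simps)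
    thus ?thesis by blast
  qed
qed

lemma not_p_square_dvd_phi: "\<not> int p * int p dvd phi x"
proof -
  have two: "\<not> 4 dvd x * x + 1"
  proof -
    have "\<exists>y. x = 2 * y \<or> x = 2 * y + 1" by presburger
    then obtain y where "x = 2 * y \<or> x = 2 * y + 1" ..
    moreover define z where "z = y * y"
    ultimately have "x * x = 4 * z \<or> x * x = 4 * z + 4 * y + 1" by (auto simp: algebra_simps)
    thus ?thesis by presburger
  qed
  have three: "\<not> 9 dvd x * x + x + 1" for x :: int
  proof -
    have "\<exists>y. x = 3 * y \<or> x = 3 * y + 1 \<or> x = 3 * y + 2" by presburger
    then obtain y where "x = 3 * y \<or> x = 3 * y + 1 \<or> x = 3 * y + 2" ..
    moreover define z where "z = y * y"
    ultimately have "x * x + x + 1 = 9 * z + 3 * y + 1 \<or> x * x + x + 1 = 9 * z + 9 * y + 3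
        \<or> x * x + x + 1 = 9 * z + 15 * y + 7" by (auto simp: algebra_simps)
    thus ?thesis by presburger
  qed
  \<comment> \<open>For \<open>k = 6\<close> the value \<open>phi x\<close> is
    \<open>y * y + y + 1\<close> at \<open>y = - x\<close>.\<close>
  show ?thesis
    using params two three[of x] three[of "- x"] by (auto simp: phi_def)
qed

text \<open>Roots modulo a prime other than \<open>p\<close> are simple, because a common divisor of
  value and derivative divides \<open>p\<close>.\<close>

lemma coprime_derivative:
  assumes "prime q" "q \<noteq> int p" "q dvd phi x"
  shows "\<not> q dvd 2 * x + c"
proof
  assume "q dvd 2 * x + c"
  with assms(3) p_eq_combination[of x] have "q dvd int p"
    by (metis dvd_add dvd_mult)
  thus False
    using assms(1,2) prime_p primes_dvd_imp_eq[of q "int p"] by simp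
qed

text \<open>The combination for \<open>p\<close> gives \<open>p a = d m\<close>. If \<open>p\<close>
  divides \<open>m\<close>, cancel \<open>p\<close>. Otherwise \<open>p\<close> divides
  \<open>d\<close>, and then \<open>d dvd a * a\<close> forces \<open>p^2\<close> to divide
  \<open>d\<close> and hence \<open>phi x\<close>, which is impossible.\<close>

lemma dvd_leading_coefficient:
  assumes "d dvd a * a" "d dvd a * (2 * x + c)" "d dvd phi x"
  shows "d dvd a"
proof -
  obtain s t where st: "int p = s * phi x + t * (2 * x + c)"
    using p_eq_combination by blast
  have "d dvd int p * a"
  proof -
    have "int p * a = (s * a) * phi x + t * (a * (2 * x + c))"
      unfolding st by (simp add: algebra_simps)
    thus ?thesis using assms(2,3) by (metis dvd_add dvd_mult)
  qed
  then obtain m where m: "int p * a = d * m" by blast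
  have pp: "prime (int p)" using prime_p by simp
  hence p0: "int p \<noteq> 0" by (metis not_prime_0)
  show ?thesis
  proof (cases "int p dvd m")
    case True
    then obtain n where "m = int p * n" by blast
    with m p0 have "a = d * n" by simp
    thus ?thesis by simp
  next
    case False
    hence "int p dvd d"
      using m pp by (metis dvd_triv_left prime_dvd_mult_iff)
    then obtain d' where d': "d = int p * d'" by blast
    with m p0 have a: "a = d' * m" by simp
    \<comment> \<open>\<open>d' = 0\<close> would give \<open>phi x = 0\<close>, a multiple of
      \<open>p^2\<close>.\<close>
    have "d' \<noteq> 0"
      using assms(3) d' not_p_square_dvd_phi[of x] by auto
    moreover have "d' * int p dvd d' * (d' * m * m)"
      using assms(1) unfolding d' a by (simp add: algebra_simps)
    ultimately have "int p dvd d' * m * m" by simp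
    with False pp have "int p dvd d'" by (auto simp: prime_dvd_mult_iff)
    hence "int p * int p dvd d" unfolding d' by simp
    with assms(3) not_p_square_dvd_phi show ?thesis by (blast intro: dvd_trans)
  qed
qed

text \<open>Used to show that \<open>phi (d X + x) / d\<close>, as a polynomial in \<open>X\<close>,
  has content 1. A common divisor \<open>e\<close> of its coefficients divides \<open>p\<close>,
  while \<open>e^2\<close> divides \<open>phi x\<close>; so \<open>e\<close> is not associated to
  \<open>p\<close> and must be a unit.\<close>

lemma content_unit:
  assumes "e dvd d" "e dvd 2 * x + c" "d * e dvd phi x"
  shows "e dvd 1"
proof -
  obtain s t where st: "int p = s * phi x + t * (2 * x + c)"
    using p_eq_combination by blast
  have "e dvd phi x" using assms(3) by (metis dvd_mult_right)
  with assms(2) have "e dvd int p" unfolding st by simp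
  moreover have "e * e dvd phi x"
    using assms(1,3) by (meson dvd_refl dvd_trans mult_dvd_mono)
  ultimately show ?thesis
  proof -
    assume e: "e dvd int p" "e * e dvd phi x"
    then obtain f where f: "int p = e * f" by blast
    have "prime_elem (int p)" using prime_p by simp
    hence "is_unit e \<or> is_unit f" using f
      by (metis irreducible_mult_unit_left irreducibleD prime_elem_imp_irreducible)
    moreover have "is_unit f \<Longrightarrow> int p dvd e"
      using f by simp
    ultimately show ?thesis
      using e not_p_square_dvd_phi by (meson dvd_trans mult_dvd_mono)
  qed
qed

section \<open>Primitive linear pairs\<close>

lemma cyclotomic_k: "cyclotomic k = [:1, c, 1:]"
  using params cyclotomic_3 cyclotomic_4 cyclotomic_6 by auto

lemma cyclotomic_pcompose_linear:
  "pcompose (cyclotomic k) ([:b, a:] - 1) = [:phi (b - 1), a * (2 * (b - 1) + c), a * a:]"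
  by (simp add: cyclotomic_k pcompose_pCons one_pCons phi_def algebra_simps)

text \<open>Carries the defining relation of a pair along a substitution.\<close>

lemma pcompose_cyclotomic_diff_one:
  "pcompose (pcompose (cyclotomic k) (t - 1)) h = pcompose (cyclotomic k) (pcompose t h - 1)"
  by (simp add: pcompose_diff pcompose_1 flip: pcompose_assoc)

lemma dvd_coefficients:
  assumes "pcompose (cyclotomic k) ([:b, a:] - 1) = smult d r"
  shows "d dvd phi (b - 1)" "d dvd a * (2 * (b - 1) + c)" "d dvd a * a"
  using assms unfolding cyclotomic_pcompose_linear poly_eq_iff
  by (metis coeff_smult coeff_pCons_0 dvd_triv_left,
      metis coeff_smult coeff_pCons_0 coeff_pCons_Suc dvd_triv_left,
      metis coeff_smult coeff_pCons_0 coeff_pCons_Suc dvd_triv_left)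

lemma linear_pair_dvd:
  assumes "pcompose (cyclotomic k) ([:b, a:] - 1) = smult d r"
  shows "d dvd a"
  using dvd_leading_coefficient dvd_coefficients[OF assms] by blast

text \<open>With \<open>a = d u\<close>, the pair is deduced via \<open>x \<mapsto> u x\<close> from
  one with the same \<open>b\<close> and leading coefficient \<open>d\<close>. Primitivity makes
  this deduction reversible, so \<open>a\<close> also divides \<open>d\<close>.\<close>

lemma primitive_leading_coefficient:
  assumes "primitive_pair ([:b, a:], r)" "a \<noteq> 0" "d > 0"
    and eq: "pcompose (cyclotomic k) ([:b, a:] - 1) = smult d r"
  shows "\<bar>a\<bar> = d"
proof -
  obtain u where u: "a = d * u" using linear_pair_dvd[OF eq] by blast
  obtain m where m: "phi (b - 1) = d * m" using dvd_coefficients(1)[OF eq] by blast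
  define r' where "r' = [:m, 2 * (b - 1) + c, d:]"
  have eq': "pcompose (cyclotomic k) ([:b, d:] - 1) = smult d r'"
    unfolding cyclotomic_pcompose_linear r'_def m by simp
  have t: "[:b, a:] = pcompose [:b, d:] [:0, u:]"
    by (simp add: u pcompose_pCons mult.commute)
  have "smult d r = smult d (pcompose r' [:0, u:])"
    unfolding eq[symmetric] t pcompose_cyclotomic_diff_one[symmetric] eq' by (simp add: pcompose_smult)
  hence "r = pcompose r' [:0, u:]" using assms(3) smult_cancel[of d] by simp
  moreover have "u \<noteq> 0" using assms(2) u by auto
  ultimately have "deduced_from ([:b, a:], r) ([:b, d:], r')"
    unfolding deduced_from_def using t by (intro exI[of _ u] exI[of _ 0]) simp
  with assms(1) have "deduced_from ([:b, d:], r') ([:b, a:], r)"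
    unfolding primitive_pair_def equivalent_pairs_def by blast
  then obtain u' v' where "[:b, d:] = pcompose [:b, a:] [:v', u':]"
    unfolding deduced_from_def by auto
  hence "a dvd d" by (simp add: pcompose_pCons)
  moreover have "d dvd a" using u by simp
  ultimately show ?thesis using assms(3) zdvd_antisym_abs by fastforce
qed

text \<open>Any pair \<open>(t', r')\<close> from which this one is deduced satisfies the same
  relation, so \<open>d\<close> divides its leading coefficient as well. Comparing leading
  coefficients leaves only \<open>u = 1\<close> or \<open>u = - 1\<close>.\<close>

lemma linear_pair_primitive:
  assumes "\<bar>a\<bar> = d" "d > 0"
    and eq: "pcompose (cyclotomic k) ([:b, a:] - 1) = smult d r"
  shows "primitive_pair ([:b, a:], r)"
  unfolding primitive_pair_def
proof (safe, goal_cases)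
  case (1 t' r')
  then obtain u v where uv: "u \<noteq> 0" "[:b, a:] = pcompose t' [:v, u:]" "r = pcompose r' [:v, u:]"
    unfolding deduced_from_def by auto
  have a0: "a \<noteq> 0" using assms by auto
  have "degree t' = 1"
    using arg_cong[OF uv(2), of degree] uv(1) a0 by (simp add: degree_pcompose)
  then obtain b' a' where t': "t' = [:b', a':]" by (metis degree1_coeffs)
  have "pcompose (pcompose (cyclotomic k) (t' - 1)) [:v, u:] = pcompose (smult d r') [:v, u:]"
    unfolding pcompose_cyclotomic_diff_one using eq uv by (simp add: pcompose_smult)
  hence "pcompose (cyclotomic k) (t' - 1) = smult d r'"
    using pcompose_linear_inject uv(1) by blast
  hence "d dvd a'" using linear_pair_dvd t' by blast
  then obtain w where w: "a' = d * w" by blast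
  have "a = a' * u" using uv(2) t' by (simp add: pcompose_pCons)
  hence "\<bar>w\<bar> * \<bar>u\<bar> = 1" using w assms(1,2) by (simp add: abs_mult mult.assoc)
  hence "\<bar>u\<bar> = 1" by (auto simp: zmult_eq_1_iff)
  thus ?case using 1 uv deduced_from_unit_imp_equivalent[of u "([:b, a:], r)" "(t', r')" v] by simp
qed

text \<open>After division by \<open>d\<close> the discriminant is \<open>c^2 - 4\<close>, which is
  negative, and the content is 1 by \<open>content_unit\<close>.\<close>

lemma linear_pair_irreducible:
  assumes "\<bar>a\<bar> = d" "d > 0"
    and eq: "pcompose (cyclotomic k) ([:b, a:] - 1) = smult d r"
  shows "irreducible r"
proof -
  obtain u where u: "a = d * u" "\<bar>u\<bar> = 1"
    using assms(1,2) by (metis abs_sgn_eq_1 mult_sgn_abs order_less_irrefl abs_0 mult.commute)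
  hence uu: "u * u = 1" by (auto simp: abs_if split: if_splits)
  obtain m where m: "phi (b - 1) = d * m" using dvd_coefficients(1)[OF eq] by blast
  have "smult d r = smult d [:m, u * (2 * (b - 1) + c), d:]"
    unfolding eq[symmetric] cyclotomic_pcompose_linear m u(1) using uu by (simp add: algebra_simps)
  hence r: "r = [:m, u * (2 * (b - 1) + c), d:]" using assms(2) smult_cancel[of d] by simp
  show ?thesis unfolding r
  proof (rule quadratic_irreducible_int_poly)
    have "(u * (2 * (b - 1) + c)) * (u * (2 * (b - 1) + c)) = (u * u) * ((2 * (b - 1) + c) * (2 * (b - 1) + c))"
      by (simp add: algebra_simps)
    also have "\<dots> = 4 * phi (b - 1) + (c * c - 4)"
      unfolding uu phi_def by (simp add: algebra_simps)
    finally show "(u * (2 * (b - 1) + c)) * (u * (2 * (b - 1) + c)) - 4 * m * d < 0"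
      using params m by auto
  next
    fix e assume e: "e dvd m" "e dvd u * (2 * (b - 1) + c)" "e dvd d"
    have "e dvd u * (u * (2 * (b - 1) + c))" using e(2) by simp
    hence "e dvd 2 * (b - 1) + c" using uu by (simp add: mult.assoc[symmetric])
    moreover have "d * e dvd phi (b - 1)" using e(1) m by simp
    ultimately show "e dvd 1" using e(3) content_unit by blast
  qed
qed

text \<open>Primitivity amounts to the leading coefficient being \<open>d\<close> up to sign, and
  irreducibility follows from that.\<close>

lemma linear_primitive_pairs_iff:
  assumes "d > 0"
  shows "(t, r) \<in> linear_primitive_pairs k d \<longleftrightarrow>
    (\<exists>b a. \<bar>a\<bar> = int d \<and> t = [:b, a:]) \<and> pcompose (cyclotomic k) (t - 1) = smult (int d) r"
proof
  assume "(t, r) \<in> linear_primitive_pairs k d"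
  thus "(\<exists>b a. \<bar>a\<bar> = int d \<and> t = [:b, a:]) \<and> pcompose (cyclotomic k) (t - 1) = smult (int d) r"
    unfolding linear_primitive_pairs_def
    using primitive_leading_coefficient assms by fastforce
next
  assume R: "(\<exists>b a. \<bar>a\<bar> = int d \<and> t = [:b, a:]) \<and> pcompose (cyclotomic k) (t - 1) = smult (int d) r"
  then obtain b a where ba: "\<bar>a\<bar> = int d" "t = [:b, a:]" by blast
  moreover from R ba have "pcompose (cyclotomic k) ([:b, a:] - 1) = smult (int d) r" by simp
  moreover have "a \<noteq> 0" using ba assms by auto
  ultimately show "(t, r) \<in> linear_primitive_pairs k d"
    unfolding linear_primitive_pairs_def
    using linear_pair_primitive linear_pair_irreducible assms by auto
qed

section \<open>Classes of pairs as roots modulo \<open>d\<close>\<close>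

definition roots_mod :: "nat \<Rightarrow> int set" where
  "roots_mod m = {x \<in> {0..<int m}. int m dvd phi x}"

lemma phi_cong: "[x = y] (mod m) \<Longrightarrow> [phi x = phi y] (mod m)"
  unfolding phi_def by (intro cong_add cong_mult cong_refl)

lemma dvd_phi_mod_iff:
  assumes "m dvd n"
  shows "m dvd phi (x mod n) \<longleftrightarrow> m dvd phi x"
proof -
  have "[x mod n = x] (mod m)" using assms by (simp add: cong_def mod_mod_cancel)
  thus ?thesis using phi_cong cong_dvd_iff by blast
qed

lemma mod_in_roots_mod_iff: "m > 0 \<Longrightarrow> x mod int m \<in> roots_mod m \<longleftrightarrow> int m dvd phi x"
  by (simp add: roots_mod_def dvd_phi_mod_iff)

text \<open>The leading coefficients agree up to sign, which fixes \<open>u\<close>; a suitable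
  \<open>v\<close> exists exactly when \<open>d\<close> divides \<open>b - b'\<close>. The second
  components then match, since \<open>t\<close> determines \<open>r\<close> through division by
  \<open>d\<close>.\<close>

lemma linear_pairs_deduced_iff:
  assumes "d > 0" "(t, r) \<in> linear_primitive_pairs k d" "(t', r') \<in> linear_primitive_pairs k d"
  shows "deduced_from (t, r) (t', r') \<longleftrightarrow> [coeff t 0 = coeff t' 0] (mod int d)"
proof -
  obtain b a b' a' where t: "t = [:b, a:]" "\<bar>a\<bar> = int d" and t': "t' = [:b', a':]" "\<bar>a'\<bar> = int d"
    and eq: "pcompose (cyclotomic k) (t - 1) = smult (int d) r"
      "pcompose (cyclotomic k) (t' - 1) = smult (int d) r'"
    using assms linear_primitive_pairs_iff by auto
  show ?thesis
  proof
    assume "deduced_from (t, r) (t', r')"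
    then obtain v where "b = b' + a' * v"
      unfolding deduced_from_def using t t' by (auto simp: pcompose_pCons)
    moreover have "int d dvd a'" using t' by (metis dvd_abs_iff dvd_refl)
    ultimately show "[coeff t 0 = coeff t' 0] (mod int d)"
      using t t' by (simp add: cong_iff_dvd_diff)
  next
    assume "[coeff t 0 = coeff t' 0] (mod int d)"
    hence "int d dvd b - b'" using t t' by (simp add: cong_iff_dvd_diff)
    hence "a' dvd b - b'" using t' by (metis abs_dvd_iff)
    then obtain v where v: "b = b' + a' * v" by (auto simp: dvd_def algebra_simps)
    have "a = a' \<or> a = - a'" using t t' by linarith
    then obtain u where u: "a = a' * u" "\<bar>u\<bar> = 1"
      by (metis abs_1 abs_minus_cancel mult.right_neutral mult_minus_right)
    have tt: "t = pcompose t' [:v, u:]"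
      by (simp add: t t' v u pcompose_pCons algebra_simps)
    have "smult (int d) r = smult (int d) (pcompose r' [:v, u:])"
      unfolding eq(1)[symmetric] tt pcompose_cyclotomic_diff_one[symmetric] eq(2)
      by (simp add: pcompose_smult)
    hence "r = pcompose r' [:v, u:]" using assms(1) smult_cancel[of "int d"] by simp
    moreover have "u \<noteq> 0" using u by auto
    ultimately show "deduced_from (t, r) (t', r')"
      unfolding deduced_from_def fst_conv snd_conv using tt by blast
  qed
qed

lemma linear_primitive_classes_roots:
  assumes "d > 0"
  shows "\<exists>h. bij_betw h (roots_mod d) (linear_primitive_classes k d)"
proof -
  define L where "L = linear_primitive_pairs k d"
  define R where "R = {(P, Q). equivalent_pairs P Q}"
  \<comment> \<open>The shift by 1 reflects that \<open>cyclotomic k\<close> is composed with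
    \<open>t - 1\<close>, whose constant term is the root.\<close>
  define f where "f P = (coeff (fst P) 0 - 1) mod int d" for P :: poly_pair
  have kernel: "f P = f Q \<longleftrightarrow> R `` {P} = R `` {Q}" if "P \<in> L" "Q \<in> L" for P Q
  proof -
    have "f P = f Q \<longleftrightarrow> [coeff (fst P) 0 = coeff (fst Q) 0] (mod int d)"
      unfolding f_def cong_def[symmetric] by (simp add: cong_iff_dvd_diff)
    also have "\<dots> \<longleftrightarrow> (P, Q) \<in> R"
      using linear_pairs_deduced_iff[OF assms, of "fst P" "snd P" "fst Q" "snd Q"]
        linear_pairs_deduced_iff[OF assms, of "fst Q" "snd Q" "fst P" "snd P"] that
      unfolding L_def R_def equivalent_pairs_def by (auto simp: cong_sym_eq)
    also have "\<dots> \<longleftrightarrow> R `` {P} = R `` {Q}"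
      using equiv_equivalent_pairs unfolding R_def[symmetric] by (simp add: eq_equiv_class_iff)
    finally show ?thesis .
  qed
  have "\<exists>h. bij_betw h (f ` L) ((\<lambda>P. R `` {P}) ` L)"
    by (rule bij_betw_images_same_kernel) (rule kernel)
  moreover have "(\<lambda>P. R `` {P}) ` L = linear_primitive_classes k d"
    unfolding linear_primitive_classes_def quotient_def R_def L_def by blast
  moreover have "f ` L = roots_mod d"
  proof
    show "f ` L \<subseteq> roots_mod d"
    proof
      fix x assume "x \<in> f ` L"
      then obtain t r where tr: "(t, r) \<in> L" "x = f (t, r)" by auto
      then obtain b a where t: "t = [:b, a:]"
        and eq: "pcompose (cyclotomic k) (t - 1) = smult (int d) r"
        unfolding L_def linear_primitive_pairs_iff[OF assms] by blast
      have "int d dvd phi (b - 1)" using dvd_coefficients(1) eq t by blast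
      thus "x \<in> roots_mod d"
        using tr(2) t assms by (simp add: f_def mod_in_roots_mod_iff)
    qed
    show "roots_mod d \<subseteq> f ` L"
    proof
      fix x assume x: "x \<in> roots_mod d"
      then obtain m where m: "phi x = int d * m" by (auto simp: roots_mod_def)
      \<comment> \<open>The root \<open>x\<close> is realised by \<open>a = d\<close> and
        \<open>b = x + 1\<close>; the second component is \<open>phi (d X + x) / d\<close>.\<close>
      have "([:x + 1, int d:], [:m, 2 * x + c, int d:]) \<in> L"
        unfolding L_def linear_primitive_pairs_iff[OF assms] cyclotomic_pcompose_linear
        using m by auto
      moreover have "f ([:x + 1, int d:], [:m, 2 * x + c, int d:]) = x"
        using x by (simp add: f_def roots_mod_def)
      ultimately show "x \<in> f ` L" by (metis image_eqI)
    qed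
  qed
  ultimately show ?thesis by simp
qed

section \<open>Counting the roots modulo \<open>d\<close>\<close>

lemma card_roots_mod_mult:
  assumes "coprime m n" "m > 0" "n > 0"
  shows "card (roots_mod (m * n)) = card (roots_mod m) * card (roots_mod n)"
proof -
  define f where "f x = (x mod int m, x mod int n)" for x
  have cop: "coprime (int m) (int n)" using assms(1) by simp
  have "bij_betw f (roots_mod (m * n)) (roots_mod m \<times> roots_mod n)"
  proof (rule bij_betw_imageI)
    show "inj_on f (roots_mod (m * n))"
    proof (rule inj_onI)
      fix x y assume xy: "x \<in> roots_mod (m * n)" "y \<in> roots_mod (m * n)" "f x = f y"
      hence "[x = y] (mod int m)" "[x = y] (mod int n)" by (auto simp: f_def cong_def)
      hence "[x = y] (mod int (m * n))" using cop by (simp add: coprime_cong_mult)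
      thus "x = y" using xy(1,2) by (simp add: roots_mod_def cong_def)
    qed
    show "f ` roots_mod (m * n) = roots_mod m \<times> roots_mod n"
    proof safe
      fix x y z assume z: "z \<in> roots_mod (m * n)" "(x, y) = f z"
      hence "int m dvd phi z" "int n dvd phi z"
        by (auto simp: roots_mod_def intro: dvd_mult_left dvd_mult_right)
      thus "x \<in> roots_mod m" "y \<in> roots_mod n"
        using z assms by (auto simp: f_def mod_in_roots_mod_iff)
    next
      fix x y assume xy: "x \<in> roots_mod m" "y \<in> roots_mod n"
      obtain z where z: "[z = x] (mod int m)" "[z = y] (mod int n)"
        using binary_chinese_remainder_int[OF cop] by blast
      have "int m dvd phi z" "int n dvd phi z"
        using xy z[THEN phi_cong] by (auto simp: roots_mod_def cong_dvd_iff)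
      hence "int (m * n) dvd phi z" using cop by (simp add: divides_mult)
      hence "z mod int (m * n) \<in> roots_mod (m * n)" using assms by (metis mod_in_roots_mod_iff nat_0_less_mult_iff)
      moreover have "f (z mod int (m * n)) = (x, y)"
        using xy z by (simp add: f_def mod_mod_cancel roots_mod_def cong_def)
      ultimately show "(x, y) \<in> f ` roots_mod (m * n)" by (metis image_eqI)
    qed
  qed
  thus ?thesis by (simp add: bij_betw_same_card card_cartesian_product)
qed

text \<open>Modulo \<open>p\<close> there is one double root, 2 for \<open>k = 6\<close> and 1
  otherwise; it does not lift to \<open>p^2\<close>.\<close>

lemma card_roots_mod_p_power: "card (roots_mod (p ^ n)) = (if n \<le> 1 then 1 else 0)"
proof -
  consider "n = 0" | "n = 1" | "n \<ge> 2" by linarith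
  thus ?thesis
  proof cases
    case 1
    have "roots_mod 1 = {0}" by (auto simp: roots_mod_def)
    with 1 show ?thesis by simp
  next
    case 2
    have "x \<in> {0..<int p} \<longleftrightarrow> x = 0 \<or> x = 1 \<or> p = 3 \<and> x = 2" for x
      using params by auto
    hence "roots_mod p =
        {x. (x = 0 \<or> x = 1 \<or> p = 3 \<and> x = 2) \<and> int p dvd x * x + c * x + 1}"
      unfolding roots_mod_def phi_def by simp
    also have "\<dots> = (if c = - 1 then {2} else {1})"
      using params by auto
    finally have "roots_mod p = (if c = - 1 then {2} else {1})" .
    with 2 show ?thesis by simp
  next
    case 3
    hence "int p * int p dvd int (p ^ n)"
      by (metis le_imp_power_dvd of_nat_dvd_iff of_nat_mult power2_eq_square)
    hence "roots_mod (p ^ n) = {}"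
      using not_p_square_dvd_phi by (auto simp: roots_mod_def dest: dvd_trans)
    with 3 show ?thesis by simp
  qed
qed

text \<open>\<open>phi x\<close> divides \<open>x^k - 1\<close>, and the cofactor accounts for
  orders properly dividing \<open>k\<close>. For \<open>q\<close> other than \<open>p\<close> the
  two factors have no common root modulo \<open>q\<close>.\<close>

lemma ord_eq_k_iff_dvd_phi:
  assumes "prime q" "q \<noteq> p"
  shows "ord q a = k \<longleftrightarrow> int q dvd phi (int a)"
proof -
  define x where "x = int a"
  have q: "prime (int q)" using assms by simp
  have ord: "int q dvd x ^ j - 1 \<longleftrightarrow> ord q a dvd j" for j
    unfolding x_def by (rule dvd_power_diff_one_iff)
  note pdm = prime_dvd_mult_iff[OF q]
  have np: "\<not> q dvd p" using assms prime_p primes_dvd_imp_eq by blast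
  consider "k = 3" "p = 3" "c = 1" | "k = 4" "p = 2" "c = 0" | "k = 6" "p = 3" "c = - 1"
    using params by auto
  thus ?thesis
  proof cases
    case 1
    have e: "x ^ 3 - 1 = (x ^ 1 - 1) * phi x"
      unfolding phi_def unfolding 1 by (simp add: algebra_simps eval_nat_numeral)
    have "ord q a = 3 \<longleftrightarrow> ord q a dvd 3 \<and> \<not> ord q a dvd 1"
      using prime_nat_iff[of 3] by fastforce
    also have "\<dots> \<longleftrightarrow> int q dvd phi x"
    proof -
      have "\<not> int q dvd x ^ 1 - 1" if "int q dvd phi x"
      proof
        assume "int q dvd x ^ 1 - 1"
        \<comment> \<open>Reducing \<open>phi x\<close> modulo \<open>x - 1\<close> leaves its value
          at 1, which is 3.\<close>
        with that have "int q dvd phi x - (x + 2) * (x ^ 1 - 1)" by (metis dvd_diff dvd_mult)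
        also have "\<dots> = int p" unfolding phi_def unfolding 1 by (simp add: algebra_simps)
        finally show False using np by simp
      qed
      thus ?thesis unfolding ord[symmetric] e pdm by blast
    qed
    finally show ?thesis using 1 by (simp add: x_def)
  next
    case 2
    have e: "x ^ 4 - 1 = (x ^ 2 - 1) * phi x"
      unfolding phi_def unfolding 2 by (simp add: algebra_simps eval_nat_numeral)
    have "ord q a = 4 \<longleftrightarrow> ord q a dvd 4 \<and> \<not> ord q a dvd 2"
    proof -
      have "n \<in> {1, 2, 4}" if "n dvd 4" for n :: nat
      proof -
        have "n = 0 \<or> n = 1 \<or> n = 2 \<or> n = 3 \<or> n = 4" using dvd_imp_le[OF that] by linarith
        thus ?thesis using that by auto
      qed
      thus ?thesis by fastforce
    qed
    also have "\<dots> \<longleftrightarrow> int q dvd phi x"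
    proof -
      have "\<not> int q dvd x ^ 2 - 1" if "int q dvd phi x"
      proof
        assume "int q dvd x ^ 2 - 1"
        with that have "int q dvd phi x - (x ^ 2 - 1)" by (metis dvd_diff)
        also have "\<dots> = int p" unfolding phi_def unfolding 2 by (simp add: algebra_simps eval_nat_numeral)
        finally show False using np by simp
      qed
      thus ?thesis unfolding ord[symmetric] e pdm by blast
    qed
    finally show ?thesis using 2 by (simp add: x_def)
  next
    case 3
    have e: "x ^ 6 - 1 = (x ^ 3 - 1) * ((x + 1) * phi x)" "x ^ 2 - 1 = (x - 1) * (x + 1)"
      unfolding phi_def unfolding 3 by (simp_all add: algebra_simps eval_nat_numeral)
    have "ord q a = 6 \<longleftrightarrow> ord q a dvd 6 \<and> \<not> ord q a dvd 3 \<and> \<not> ord q a dvd 2"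
    proof -
      have "n \<in> {1, 2, 3, 6}" if "n dvd 6" for n :: nat
      proof -
        have "n = 0 \<or> n = 1 \<or> n = 2 \<or> n = 3 \<or> n = 4 \<or> n = 5 \<or> n = 6"
          using dvd_imp_le[OF that] by linarith
        thus ?thesis using that by auto
      qed
      thus ?thesis by fastforce
    qed
    also have "\<dots> \<longleftrightarrow> int q dvd phi x"
    proof -
      have "\<not> int q dvd x ^ 3 - 1" if "int q dvd phi x"
      proof
        assume a: "int q dvd x ^ 3 - 1"
        with that have "int q dvd (x + 1) * phi x - (x ^ 3 - 1)" by (metis dvd_diff dvd_mult)
        also have "\<dots> = int 2" unfolding phi_def unfolding 3 by (simp add: algebra_simps eval_nat_numeral)
        finally have "q dvd 2" by (simp only: of_nat_dvd_iff)
        hence "q = 2" using assms(1) by (metis primes_dvd_imp_eq two_is_prime_nat)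
        \<comment> \<open>\<open>x * x - x\<close> is even, so \<open>phi x\<close> is odd.\<close>
        with that show False unfolding phi_def unfolding 3 by simp
      qed
      moreover have "\<not> int q dvd x ^ 2 - 1" if "int q dvd phi x"
      proof
        assume "int q dvd x ^ 2 - 1"
        \<comment> \<open>Dividing \<open>(x^2 - 1)^2\<close> by \<open>phi x\<close> gives quotient
          \<open>x^2 + x - 2\<close> and remainder \<open>3 (1 - x)\<close>.\<close>
        with that have "int q dvd (x ^ 2 - 1) * (x ^ 2 - 1) - (x * x + x - 2) * phi x"
          by (metis dvd_diff dvd_mult dvd_mult2)
        also have "\<dots> = int p * (1 - x)"
          unfolding phi_def unfolding 3 by (simp add: algebra_simps eval_nat_numeral)
        finally have "int q dvd 1 - x" using np pdm by simp
        with that have "int q dvd phi x + x * (1 - x)" by (metis dvd_add dvd_mult)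
        also have "\<dots> = 1" unfolding phi_def unfolding 3 by (simp add: algebra_simps)
        finally show False using q by (simp add: not_prime_unit)
      qed
      ultimately show ?thesis unfolding ord[symmetric] e pdm by blast
    qed
    finally show ?thesis using 3 by (simp add: x_def)
  qed
qed

text \<open>Roots are elements of order \<open>k\<close> in the cyclic unit group modulo
  \<open>q\<close>, and these exist exactly when \<open>k\<close> divides
  \<open>q - 1\<close>.\<close>

lemma exists_root_mod_prime_iff:
  assumes "prime q" "q \<noteq> p"
  shows "(\<exists>x. int q dvd phi x) \<longleftrightarrow> [q = 1] (mod k)"
proof -
  have k: "k > 0" using params by auto
  have q1: "q \<ge> 1" using assms(1) by (rule prime_ge_1_nat)
  have "(\<exists>x. int q dvd phi x) \<longleftrightarrow> (\<exists>a. ord q a = k)"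
  proof
    assume "\<exists>x. int q dvd phi x"
    then obtain x where "int q dvd phi x" ..
    hence "int q dvd phi (int (nat (x mod int q)))"
      using q1 by (simp add: dvd_phi_mod_iff)
    thus "\<exists>a. ord q a = k" using ord_eq_k_iff_dvd_phi[OF assms] by blast
  next
    assume "\<exists>a. ord q a = k"
    thus "\<exists>x. int q dvd phi x" using ord_eq_k_iff_dvd_phi[OF assms] by blast
  qed
  also have "\<dots> \<longleftrightarrow> k dvd q - 1"
  proof
    assume "\<exists>a. ord q a = k"
    then obtain a where a: "ord q a = k" ..
    \<comment> \<open>\<open>ord q a\<close> is 0 exactly when \<open>a\<close> is not coprime to
      \<open>q\<close>, so a positive order gives coprimality.\<close>
    hence "coprime q a" using k ord_eq_0[of q a] by auto
    thus "k dvd q - 1" using order_divides_totient a assms(1) by (metis totient_prime)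
  next
    assume "k dvd q - 1"
    hence "card {x \<in> totatives q. ord q x = k} = totient k"
      using prime_card_elements_with_ord_eq_totient[OF prime_gt_1_nat[OF assms(1)] assms(1)]
      by simp
    hence "card {x \<in> totatives q. ord q x = k} \<noteq> 0" using k by simp
    hence "{x \<in> totatives q. ord q x = k} \<noteq> {}" by (metis card.empty)
    thus "\<exists>a. ord q a = k" by blast
  qed
  also have "\<dots> \<longleftrightarrow> [q = 1] (mod k)"
    using q1 by (simp add: cong_altdef_nat)
  finally show ?thesis .
qed

lemma hensel_lift:
  assumes "prime q" "q \<noteq> p" "int q dvd phi x0"
  shows "\<exists>x. int (q ^ Suc n) dvd phi x"
proof (induction n)
  case 0
  show ?case using assms by auto
next
  case (Suc n)
  then obtain x m where x: "phi x = int q ^ Suc n * m" by (auto simp: dvd_def)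
  hence "int q dvd phi x" by simp
  hence "\<not> int q dvd 2 * x + c"
    using coprime_derivative[of "int q"] assms(1,2) by simp
  hence "coprime (2 * x + c) (int q)"
    using assms(1) by (simp add: prime_imp_coprime coprime_commute)
  then obtain w where w: "[(2 * x + c) * w = 1] (mod int q)"
    using cong_solve_coprime_int by blast
  then obtain j where j: "(2 * x + c) * w - 1 = int q * j"
    by (auto simp: cong_iff_dvd_diff)
  define Q where "Q = int q ^ Suc n"
  \<comment> \<open>A Newton step: \<open>w\<close> inverts the derivative modulo \<open>q\<close>,
    so the first two terms cancel modulo \<open>q * Q\<close>, and \<open>Q * Q\<close> is a
    multiple of \<open>q * Q\<close>.\<close>
  have "phi (x - Q * (w * m)) = Q * m - Q * m * ((2 * x + c) * w) + Q * Q * (w * m) * (w * m)"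
    using x[folded Q_def] unfolding phi_def by (simp add: algebra_simps)
  also have "(2 * x + c) * w = 1 + int q * j" using j by simp
  also have "Q * Q = int q * Q * int q ^ n" by (simp add: Q_def)
  also have "Q * m - Q * m * (1 + int q * j) + int q * Q * int q ^ n * (w * m) * (w * m)
      = int q * Q * (int q ^ n * (w * m) * (w * m) - m * j)"
    by (simp add: algebra_simps)
  finally have "int (q ^ Suc (Suc n)) dvd phi (x - Q * (w * m))"
    by (simp add: Q_def)
  thus ?case ..
qed

text \<open>The roots sum to \<open>- c\<close>, so \<open>x\<close> is paired with
  \<open>y = - c - x\<close>. Their difference \<open>2 x + c\<close> is prime to \<open>q\<close>;
  hence they are distinct, and for any root \<open>z\<close> at most one of \<open>z - x\<close>,
  \<open>z - y\<close> is divisible by \<open>q\<close>, so the whole prime power divides that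
  one.\<close>

lemma card_roots_mod_prime_power:
  assumes q: "prime q" "q \<noteq> p" and n: "n \<ge> 1"
  shows "card (roots_mod (q ^ n)) = (if [q = 1] (mod k) then 2 else 0)"
proof (cases "\<exists>x. int q dvd phi x")
  case False
  have "int q dvd int (q ^ n)" using n by simp
  hence "roots_mod (q ^ n) = {}"
    using False unfolding roots_mod_def by (blast intro: dvd_trans)
  thus ?thesis using False exists_root_mod_prime_iff[OF q] by simp
next
  case True
  define Q where "Q = int (q ^ n)"
  have pos: "q ^ n > 0" using q by (simp add: prime_gt_0_nat)
  have pq: "prime (int q)" using q by simp
  have qQ: "int q dvd Q" using n by (simp add: Q_def)
  \<comment> \<open>\<open>hensel_lift\<close> yields the exponent \<open>Suc n\<close>, hence the
    index \<open>n - 1\<close>.\<close>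
  obtain x where x: "Q dvd phi x"
    using True hensel_lift[OF q, of _ "n - 1"] n unfolding Q_def by auto
  have nd: "\<not> int q dvd 2 * x + c"
    using coprime_derivative[of "int q" x] q x qQ by (auto intro: dvd_trans)
  define y where "y = - c - x"
  have y: "phi y = phi x" by (simp add: y_def phi_def algebra_simps)
  have "x mod Q \<noteq> y mod Q"
  proof
    assume "x mod Q = y mod Q"
    hence "Q dvd x - y" by (simp add: mod_eq_dvd_iff)
    hence "Q dvd 2 * x + c" by (simp add: y_def)
    thus False using nd qQ by (blast intro: dvd_trans)
  qed
  moreover have "roots_mod (q ^ n) = {x mod Q, y mod Q}"
  proof
    show "{x mod Q, y mod Q} \<subseteq> roots_mod (q ^ n)"
      using x y pos unfolding Q_def by (simp only: mod_in_roots_mod_iff empty_subsetI insert_subset)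
    show "roots_mod (q ^ n) \<subseteq> {x mod Q, y mod Q}"
    proof
      fix z assume z: "z \<in> roots_mod (q ^ n)"
      hence zz: "z mod Q = z" "Q dvd phi z" by (auto simp: roots_mod_def Q_def)
      have "phi z - phi x = (z - x) * (z - y)" by (simp add: y_def phi_def algebra_simps)
      hence dvd: "Q dvd (z - x) * (z - y)" using x zz(2) by (metis dvd_diff)
      have "\<not> (int q dvd z - x \<and> int q dvd z - y)"
      proof
        assume "int q dvd z - x \<and> int q dvd z - y"
        hence "int q dvd (z - y) - (z - x)" by (blast intro: dvd_diff)
        thus False using nd by (simp add: y_def algebra_simps)
      qed
      hence "coprime Q (z - x) \<or> coprime Q (z - y)"
        using prime_imp_coprime[OF pq] unfolding Q_def by auto
      hence "Q dvd z - y \<or> Q dvd z - x"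
        using dvd by (metis coprime_dvd_mult_right_iff coprime_dvd_mult_left_iff)
      hence "z mod Q = y mod Q \<or> z mod Q = x mod Q" by (simp add: mod_eq_dvd_iff)
      thus "z \<in> {x mod Q, y mod Q}" using zz(1) by auto
    qed
  qed
  ultimately show ?thesis using True exists_root_mod_prime_iff[OF q] by simp
qed

lemma card_roots_mod_prod:
  assumes "finite A" "inj_on q A" "\<And>i. i \<in> A \<Longrightarrow> prime (q i) \<and> q i \<noteq> p \<and> u i \<ge> 1"
  shows "card (roots_mod (\<Prod>i\<in>A. q i ^ u i)) =
    (if \<forall>i\<in>A. [q i = 1] (mod k) then 2 ^ card A else 0)"
  using assms
proof (induction rule: finite_induct)
  case empty
  show ?case using card_roots_mod_p_power[of 0] by simp
next
  case (insert j A)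
  have "coprime (q j ^ u j) (\<Prod>i\<in>A. q i ^ u i)"
  proof (rule prod_coprime_right)
    fix i assume "i \<in> A"
    moreover from this have "q i \<noteq> q j"
      using insert.hyps(2) insert.prems(1) by (metis inj_on_eq_iff insertCI)
    ultimately show "coprime (q j ^ u j) (q i ^ u i)"
      using insert.prems(2) primes_coprime[of "q j" "q i"] by simp
  qed
  moreover have "q j ^ u j > 0" "(\<Prod>i\<in>A. q i ^ u i) > 0"
    using insert.prems(2) by (auto intro!: prod_pos simp: prime_gt_0_nat)
  ultimately have "card (roots_mod (\<Prod>i\<in>insert j A. q i ^ u i)) =
      card (roots_mod (q j ^ u j)) * card (roots_mod (\<Prod>i\<in>A. q i ^ u i))"
    using insert.hyps by (simp add: card_roots_mod_mult)
  thus ?case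
    using insert card_roots_mod_prime_power[of "q j" "u j"] by auto
qed

lemma card_roots_mod:
  assumes "\<And>i. i \<in> {1..s} \<Longrightarrow> prime (q i) \<and> q i \<noteq> p \<and> u i \<ge> 1" "inj_on q {1..s}"
  shows "card (roots_mod (p ^ n * (\<Prod>i = 1..s. q i ^ u i))) =
    (if (\<forall>i\<in>{1..s}. [q i = 1] (mod k)) \<and> n \<le> 1 then 2 ^ s else 0)"
proof -
  have "coprime (p ^ n) (\<Prod>i = 1..s. q i ^ u i)"
    using assms(1) prime_p by (intro prod_coprime_right)
      (metis coprime_power_left_iff coprime_power_right_iff primes_coprime)
  moreover have "p ^ n > 0" "(\<Prod>i = 1..s. q i ^ u i) > 0"
    using assms(1) prime_p by (auto intro!: prod_pos simp: prime_gt_0_nat)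
  ultimately show ?thesis
    using card_roots_mod_prod[of "{1..s}" q u] assms
    by (simp add: card_roots_mod_mult card_roots_mod_p_power)
qed

end

theorem proposition4p4:
  fixes k p d s :: nat and q u :: "nat \<Rightarrow> nat"
  assumes "k \<in> {3, 4, 6}"
    and "p = Max (prime_factors k)"
    and "d > 0"
    and "d = p ^ u 0 * (\<Prod>i = 1..s. q i ^ u i)"
    and "\<And>i. i \<in> {1..s} \<Longrightarrow> prime (q i) \<and> q i \<noteq> p \<and> u i \<ge> 1"
    and "inj_on q {1..s}"
  shows "finite (linear_primitive_classes k d) \<and>
    card (linear_primitive_classes k d) =
      (if d = 1 \<or> d = p then 1
       else if (\<forall>i\<in>{1..s}. [q i = 1] (mod k)) \<and> u 0 \<le> 1 then 2 ^ s
       else 0)"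
proof -
  define c :: int where "c = (if k = 3 then 1 else if k = 4 then 0 else - 1)"
  have "prime_factors (3 :: nat) = {3}" by (simp add: prime_prime_factors)
  \<comment> \<open>4 and 6 are written as products so that \<open>prime_factors_product\<close>
    applies.\<close>
  moreover have "prime_factors (2 * 2 :: nat) = {2}"
    by (subst prime_factors_product) (simp_all add: prime_prime_factors)
  moreover have "prime_factors (2 * 3 :: nat) = {2, 3}"
    by (subst prime_factors_product) (auto simp add: prime_prime_factors)
  ultimately have "(k, p, c) \<in> {(3, 3, 1), (4, 2, 0), (6, 3, - 1)}"
    using assms(1,2) by (auto simp: c_def)
  then interpret quadratic_cyclotomic k p c by unfold_locales
  obtain h where h: "bij_betw h (roots_mod d) (linear_primitive_classes k d)"
    using linear_primitive_classes_roots[OF assms(3)] by blast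
  have "card (roots_mod d) = (if (\<forall>i\<in>{1..s}. [q i = 1] (mod k)) \<and> u 0 \<le> 1 then 2 ^ s else 0)"
    unfolding assms(4) by (rule card_roots_mod[OF assms(5,6)])
  \<comment> \<open>Here the modulus is \<open>p^0\<close> or \<open>p^1\<close>, so the count comes
    directly from the powers of \<open>p\<close>, without determining \<open>s\<close> from the
    factorisation.\<close>
  moreover have "card (roots_mod d) = 1" if "d = 1 \<or> d = p"
    using that card_roots_mod_p_power[of 0] card_roots_mod_p_power[of 1] by auto
  moreover have "finite (roots_mod d)"
    unfolding roots_mod_def by (rule finite_subset[of _ "{0..<int d}"]) auto
  ultimately show ?thesis
    using h bij_betw_finite[OF h] bij_betw_same_card[OF h] by auto
qed

end
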